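(* Let $0<\delta<1$ and let $\mathbb{S}$ be a collection of separated $(\delta^{-1},\delta^{-2},\delta^{-2})$-Vinogradov plates in $[-\delta^{-2},\delta^{-2}]^3$. Assume that for each $I\in\mathbb{I}_\delta$ there are at most $N$ plates $S_I\in\mathbb{S}$ associated with $I$. For $r\ge1$, let $\mathcal{Q}_r$ be a collection of pairwise disjoint cubes $q$ with side length $\sim\delta^{-1}$ that intersect at least $r$ plates $S\in\mathbb{S}$. Then for each $r\ge1$ we have $$|\mathcal{Q}_r|\lessapprox\frac{|\mathbb{S}|\,N^2\,\delta^{-3}}{r^4}.$$
   Context: Let $\Gamma(t)=(t,t^2,t^3)$, $t\in[0,1]$. $\mathbb{I}_\delta$ is the partition of $[0,1]$ into intervals of length $\delta$. For $I=[c,c+\delta]$, $\mathbf t(I)$ is the unit tangent vector of $\Gamma$ at $\Gamma(c)$. A $(\delta^{-1},\delta^{-2},\delta^{-2})$-Vinogradov plate $S_I$ associated with $I$ is a plate with one edge of length $\delta^{-1}$ and two edges of length $\delta^{-2}$, whose normal vector is $\mathbf t(I)$; it is essentially a translate of $$\{x\in\mathbb{R}^3:\ |x_1+2cx_2+3c^2x_3|\le\delta^{-1},\ |x_2+3cx_3|\le\delta^{-2},\ |x_3|\le\delta^{-2}\}.$$ Dimensions are understood up to $O(1)$ multiplicative factors. A collection of plates is separated if, for each $I$, the (mutually parallel) plates corresponding to $I$ have bounded overlap. $X\lessapprox Y$ means $X\le C(\log\delta^{-1})^{C}Y$ for an absolute constant $C$ (for small $\delta$). *)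

theory Defs
  imports "HOL-Analysis.Analysis"
begin

definition moment_curve :: "real \<Rightarrow> real^3" where
  "moment_curve t = vector [t, t^2, t^3]"

definition unit_tangent :: "real set \<Rightarrow> real^3" where
  "unit_tangent I = sgn (vector_derivative moment_curve (at (Inf I)))"

text \<open>If \<open>1 / \<delta>\<close> is a natural number this is the partition of \<open>[0,1]\<close> into intervals of
  length \<open>\<delta>\<close>. For other \<open>\<delta>\<close> no exact partition exists, and the last interval is
  allowed to stick out of \<open>[0,1]\<close>; its left endpoint, the only point used below, does not.\<close>

definition intervals :: "real \<Rightarrow> real set set" where
  "intervals \<delta> = {{c..c + \<delta>} | c. c < 1 \<and> (\<exists>j::nat. c = real j * \<delta>)}"

definition orthonormal_frame :: "(3 \<Rightarrow> real^3) \<Rightarrow> bool" where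
  "orthonormal_frame e \<longleftrightarrow> (\<forall>i j. e i \<bullet> e j = (if i = j then 1 else 0))"

text \<open>The closed and the open rectangular box with centre \<open>p\<close> and with edges of (full) length
  \<open>l $ i\<close> in the directions \<open>e i\<close>.\<close>

definition rect_box :: "real^3 \<Rightarrow> (3 \<Rightarrow> real^3) \<Rightarrow> real^3 \<Rightarrow> (real^3) set" where
  "rect_box p e l = {x. \<forall>i. \<bar>(x - p) \<bullet> e i\<bar> \<le> l $ i / 2}"

definition open_rect_box :: "real^3 \<Rightarrow> (3 \<Rightarrow> real^3) \<Rightarrow> real^3 \<Rightarrow> (real^3) set" where
  "open_rect_box p e l = {x. \<forall>i. \<bar>(x - p) \<bullet> e i\<bar> < l $ i / 2}"

definition plate_dims :: "real \<Rightarrow> real^3" where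
  "plate_dims \<delta> = vector [1 / \<delta>, 1 / \<delta>^2, 1 / \<delta>^2]"

text \<open>The parameter \<open>K\<close> is the implicit constant in every ``up to \<open>O(1)\<close> factors''. A plate
  is a convex set that agrees, up to dilation by factors \<open>1 / K\<close> and \<open>K\<close> about a common centre, with
  a rectangular box whose short edge points in the tangent direction. For \<open>0 < \<delta> \<le> 1\<close> and
  \<open>K\<close> at least some absolute constant, this covers both the boxes themselves and the translates of
  \<open>{x. \<bar>x$1 + 2*c*x$2 + 3*c^2*x$3\<bar> \<le> 1/\<delta> \<and> \<bar>x$2 + 3*c*x$3\<bar> \<le> 1/\<delta>^2 \<and> \<bar>x$3\<bar> \<le> 1/\<delta>^2}\<close>.\<close>

definition vinogradov_plate :: "real \<Rightarrow> real \<Rightarrow> real set \<Rightarrow> (real^3) set \<Rightarrow> bool" where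
  "vinogradov_plate K \<delta> I S \<longleftrightarrow> convex S \<and>
     (\<exists>p e. orthonormal_frame e \<and> e 1 = unit_tangent I \<and>
        rect_box p e ((1 / K) *\<^sub>R plate_dims \<delta>) \<subseteq> S \<and>
        S \<subseteq> rect_box p e (K *\<^sub>R plate_dims \<delta>))"

text \<open>A collection of plates is a set of pairs \<open>(I, S)\<close>: each plate \<open>S\<close> is recorded together
  with the interval \<open>I\<close> with which it is associated, since a set alone need not determine \<open>I\<close>.\<close>

type_synonym plates = "(real set \<times> (real^3) set) set"

definition plates_of :: "plates \<Rightarrow> real set \<Rightarrow> (real^3) set set" where
  "plates_of \<S> I = {S. (I, S) \<in> \<S>}"

definition plate_collection :: "real \<Rightarrow> real \<Rightarrow> plates \<Rightarrow> bool" where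
  "plate_collection K \<delta> \<S> \<longleftrightarrow> finite \<S> \<and>
     (\<forall>(I, S) \<in> \<S>. I \<in> intervals \<delta> \<and> vinogradov_plate K \<delta> I S \<and>
        S \<subseteq> {x. \<forall>i. \<bar>x $ i\<bar> \<le> 1 / \<delta>^2})"

definition separated :: "real \<Rightarrow> real \<Rightarrow> plates \<Rightarrow> bool" where
  "separated K \<delta> \<S> \<longleftrightarrow>
     (\<forall>I \<in> intervals \<delta>. \<forall>x. real (card {S \<in> plates_of \<S> I. x \<in> S}) \<le> K)"

text \<open>A cube may contain any part of its boundary, so that half-open cubes tiling the space count
  as pairwise disjoint; it need not be parallel to the axes.\<close>

definition is_cube :: "real \<Rightarrow> (real^3) set \<Rightarrow> bool" where
  "is_cube s q \<longleftrightarrow> s > 0 \<and>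
     (\<exists>p e. orthonormal_frame e \<and>
        open_rect_box p e (vec s) \<subseteq> q \<and> q \<subseteq> rect_box p e (vec s))"

definition rich_cubes :: "real \<Rightarrow> real \<Rightarrow> plates \<Rightarrow> real \<Rightarrow> (real^3) set set \<Rightarrow> bool" where
  "rich_cubes K \<delta> \<S> r Q \<longleftrightarrow> disjoint Q \<and>
     (\<forall>q \<in> Q. (\<exists>s. is_cube s q \<and> 1 / (K * \<delta>) \<le> s \<and> s \<le> K / \<delta>) \<and>
        r \<le> real (card {(I, S) \<in> \<S>. S \<inter> q \<noteq> {}}))"

end

theory Submission
  imports Defs
begin

text \<open>A plate associated with the interval starting at \<open>c\<close> lies in a slab
  \<open>\<bar>x \<bullet> (1, 2c, 3c\<^sup>2) - d\<bar> \<lesssim> 1 / \<delta>\<close>. Three slabs with distinct \<open>c\<^sub>1, c\<^sub>2, c\<^sub>3\<close> meet in a set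
  of volume \<open>\<lesssim> \<delta>\<^sup>-\<^sup>3 / V\<close>, where \<open>V\<close> is the Vandermonde product
  \<open>\<bar>c\<^sub>1 - c\<^sub>2\<bar> \<bar>c\<^sub>2 - c\<^sub>3\<bar> \<bar>c\<^sub>1 - c\<^sub>3\<bar>\<close>, so at most \<open>O(1 / V)\<close> disjoint cubes meet all three plates. By
  separation a cube meets only \<open>O(1)\<close> plates for each interval, so an \<open>r\<close>-rich cube meets
  \<open>\<gtrsim> r\<^sup>3\<close> triples of plates with distinct intervals and \<open>\<bar>c\<^sub>1 - c\<^sub>2\<bar> \<gtrsim> r \<delta>\<close>. Summing \<open>1 / V\<close> over
  all such triples costs \<open>\<bar>\<S>\<bar> N\<^sup>2 \<delta>\<^sup>-\<^sup>3 / r\<close> up to logarithms, and dividing by \<open>r\<^sup>3\<close> gives the bound.\<close>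

section \<open>Counting triples\<close>

lemma card_le_fibres:
  fixes M :: real
  assumes "finite A" "\<And>y. y \<in> f ` A \<Longrightarrow> real (card {x \<in> A. f x = y}) \<le> M"
  shows "real (card A) \<le> M * real (card (f ` A))"
proof -
  have "card A = (\<Sum>y \<in> f ` A. card {x \<in> A. f x = y})"
    using sum.group[OF assms(1) finite_imageI[OF assms(1)] subset_refl, where h = "\<lambda>_. 1::nat" and g = f] by simp
  also have "real \<dots> \<le> (\<Sum>y \<in> f ` A. M)"
    unfolding of_nat_sum by (rule sum_mono) (use assms in auto)
  finally show ?thesis by (simp add: mult.commute)
qed

lemma sum_fibres_le:
  fixes g :: "'b \<Rightarrow> real"
  assumes "finite A" "finite B" "f ` A \<subseteq> B" "\<And>y. y \<in> B \<Longrightarrow> g y \<ge> 0"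
    "\<And>y. y \<in> B \<Longrightarrow> real (card {x \<in> A. f x = y}) \<le> N"
  shows "(\<Sum>x\<in>A. g (f x)) \<le> N * (\<Sum>y\<in>B. g y)"
proof -
  have "(\<Sum>x\<in>A. g (f x)) = (\<Sum>y\<in>B. \<Sum>x\<in>{x \<in> A. f x = y}. g (f x))"
    using sum.group[OF assms(1-3), where h = "\<lambda>x. g (f x)"] by simp
  also have "\<dots> = (\<Sum>y\<in>B. real (card {x \<in> A. f x = y}) * g y)"
    by (intro sum.cong) auto
  also have "\<dots> \<le> (\<Sum>y\<in>B. N * g y)"
    by (intro sum_mono mult_right_mono) (use assms in auto)
  finally show ?thesis by (simp add: sum_distrib_left)
qed

section \<open>Harmonic bounds for sums of inverse Vandermonde products\<close>

lemma sum_inverse_dist_le: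
  assumes "i < n"
  shows "(\<Sum>j\<in>{..<n} - {i}. 1 / \<bar>real i - real j\<bar>) \<le> 2 * harm n"
proof -
  have eq: "{..<n} - {i} = {..<i} \<union> {Suc i..<n}" using assms by auto
  have "(\<Sum>j\<in>{..<n} - {i}. 1 / \<bar>real i - real j\<bar>)
    = (\<Sum>j\<in>{..<i}. 1 / \<bar>real i - real j\<bar>) + (\<Sum>j\<in>{Suc i..<n}. 1 / \<bar>real i - real j\<bar>)"
    unfolding eq by (rule sum.union_disjoint) auto
  also have "(\<Sum>j\<in>{..<i}. 1 / \<bar>real i - real j\<bar>) = (\<Sum>k\<in>{1..i}. inverse (real k))"
    by (rule sum.reindex_bij_witness[of _ "\<lambda>k. i - k" "\<lambda>j. i - j"]) (auto simp: field_simps)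
  also have "\<dots> \<le> harm n"
    unfolding harm_def by (rule sum_mono2) (use assms in auto)
  also have "(\<Sum>j\<in>{Suc i..<n}. 1 / \<bar>real i - real j\<bar>) = (\<Sum>k\<in>{1..<n-i}. inverse (real k))"
    by (rule sum.reindex_bij_witness[of _ "\<lambda>k. i + k" "\<lambda>j. j - i"]) (auto simp: field_simps)
  also have "\<dots> \<le> harm n"
    unfolding harm_def by (rule sum_mono2) auto
  finally show ?thesis by simp
qed

text \<open>Partial fractions: if \<open>a\<close> and \<open>b\<close> are the distances from
  \<open>k\<close> to \<open>i\<close> and to \<open>l\<close>, then
  \<open>1 / (a * b) = (1 / a + 1 / b) / (a + b)\<close>, and \<open>a + b\<close> is at least the
  distance from \<open>i\<close> to \<open>l\<close>. This decouples the two factors that contain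
  the middle index.\<close>

lemma inverse_mult_dist_le:
  assumes "i \<noteq> k" "k \<noteq> l" "i \<noteq> l"
  shows "1 / (\<bar>real i - real k\<bar> * \<bar>real k - real l\<bar>)
    \<le> (1 / \<bar>real i - real k\<bar> + 1 / \<bar>real l - real k\<bar>) / \<bar>real i - real l\<bar>"
proof -
  define a b c where "a = \<bar>real i - real k\<bar>" and "b = \<bar>real k - real l\<bar>" and "c = \<bar>real i - real l\<bar>"
  have "a > 0" "b > 0" "c > 0" "c \<le> a + b" using assms by (auto simp: a_def b_def c_def)
  moreover have "b = \<bar>real l - real k\<bar>" by (simp add: b_def)
  ultimately show ?thesis
    unfolding a_def[symmetric] c_def[symmetric] b_def[symmetric]
    by (simp add: divide_simps)
qed

text \<open>After partial fractions the sum over \<open>k\<close> costs one factor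
  \<open>harm n\<close> and leaves \<open>1 / c ^ 2\<close>, where \<open>c\<close> is the distance
  from \<open>i\<close> to \<open>l\<close>. One factor \<open>1 / c\<close> is traded for
  \<open>1 / \<rho>\<close>; the other makes the sum over \<open>l\<close> harmonic again. Keeping
  \<open>i\<close> and \<open>l\<close> apart is therefore what saves \<open>\<rho>\<close>.\<close>

lemma sum_inverse_vandermonde_le:
  assumes i: "i < n" and \<rho>: "\<rho> > 0"
  shows "(\<Sum>l\<in>{l\<in>{..<n}. \<rho> \<le> \<bar>real i - real l\<bar>}. \<Sum>k\<in>{..<n} - {i, l}.
    1 / (\<bar>real i - real k\<bar> * \<bar>real k - real l\<bar> * \<bar>real i - real l\<bar>)) \<le> 8 * harm n ^ 2 / \<rho>"
    (is "(\<Sum>l\<in>?B. ?g l) \<le> _")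
proof -
  have h: "harm n \<ge> (0::real)" by (rule harm_nonneg)
  have "?g l \<le> 4 * harm n / \<rho> * (1 / \<bar>real i - real l\<bar>)" if l: "l \<in> ?B" for l
  proof -
    have il: "i \<noteq> l" using l \<rho> by auto
    define c where "c = \<bar>real i - real l\<bar>"
    have c: "c > 0" "c \<ge> \<rho>" using l \<rho> by (auto simp: c_def)
    have "?g l = (\<Sum>k\<in>{..<n} - {i, l}. 1 / (\<bar>real i - real k\<bar> * \<bar>real k - real l\<bar>)) / c"
      by (simp add: sum_divide_distrib c_def)
    also have "\<dots> \<le> (\<Sum>k\<in>{..<n} - {i, l}. (1 / \<bar>real i - real k\<bar> + 1 / \<bar>real l - real k\<bar>) / c) / c"
      unfolding c_def by (intro divide_right_mono sum_mono inverse_mult_dist_le) (use il in auto)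
    also have "\<dots> = ((\<Sum>k\<in>{..<n} - {i, l}. 1 / \<bar>real i - real k\<bar>)
       + (\<Sum>k\<in>{..<n} - {i, l}. 1 / \<bar>real l - real k\<bar>)) / c / c"
      by (simp add: sum_divide_distrib sum.distrib add_divide_distrib)
    \<comment> \<open>The nonnegative term \<open>k = l\<close> is put back into the first sum and
      \<open>k = i\<close> into the second, so that each avoids only its own centre.\<close>
    also have "\<dots> \<le> ((\<Sum>k\<in>{..<n} - {i}. 1 / \<bar>real i - real k\<bar>)
       + (\<Sum>k\<in>{..<n} - {l}. 1 / \<bar>real l - real k\<bar>)) / c / c"
      by (intro divide_right_mono add_mono sum_mono2) (use c in auto)
    also have "\<dots> \<le> (2 * harm n + 2 * harm n) / c / c"
      by (intro divide_right_mono add_mono sum_inverse_dist_le) (use c l i in auto)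
    also have "\<dots> \<le> (2 * harm n + 2 * harm n) / \<rho> / c"
      by (intro divide_right_mono divide_left_mono) (use c \<rho> h in auto)
    finally show ?thesis by (simp add: c_def)
  qed
  then have "(\<Sum>l\<in>?B. ?g l) \<le> (\<Sum>l\<in>?B. 4 * harm n / \<rho> * (1 / \<bar>real i - real l\<bar>))"
    by (rule sum_mono)
  also have "\<dots> \<le> (\<Sum>l\<in>{..<n} - {i}. 4 * harm n / \<rho> * (1 / \<bar>real i - real l\<bar>))"
    by (rule sum_mono2) (use \<rho> h in auto)
  also have "\<dots> = 4 * harm n / \<rho> * (\<Sum>l\<in>{..<n} - {i}. 1 / \<bar>real i - real l\<bar>)"
    by (simp add: sum_distrib_left)
  also have "\<dots> \<le> 4 * harm n / \<rho> * (2 * harm n)"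
    by (intro mult_left_mono sum_inverse_dist_le) (use i \<rho> h in auto)
  finally show ?thesis by (simp add: power2_eq_square)
qed

lemma card_near_le:
  assumes "\<rho> > 0"
  shows "finite {l::nat. \<bar>real i - real l\<bar> < \<rho>}"
    and "real (card {l::nat. \<bar>real i - real l\<bar> < \<rho>}) \<le> 2 * \<rho> + 1"
proof -
  define k where "k = nat \<lfloor>\<rho>\<rfloor>"
  have k: "real k \<le> \<rho>" "\<rho> < real k + 1" using assms unfolding k_def by linarith+
  \<comment> \<open>For \<open>k > i\<close> the truncated difference \<open>i - k\<close> is 0; the
    interval still contains all near indices and has at most \<open>2 * k + 1\<close>
    elements.\<close>
  have sub: "{l::nat. \<bar>real i - real l\<bar> < \<rho>} \<subseteq> {i - k..i + k}"
  proof
    fix l assume "l \<in> {l::nat. \<bar>real i - real l\<bar> < \<rho>}"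
    then have "real i < real (l + k + 1)" "real l < real (i + k + 1)" using k by auto
    then show "l \<in> {i - k..i + k}" by simp
  qed
  show "finite {l::nat. \<bar>real i - real l\<bar> < \<rho>}" by (rule finite_subset[OF sub]) simp
  have "card {l::nat. \<bar>real i - real l\<bar> < \<rho>} \<le> card {i - k..i + k}" by (rule card_mono[OF _ sub]) simp
  also have "\<dots> \<le> 2 * k + 1" by simp
  finally show "real (card {l::nat. \<bar>real i - real l\<bar> < \<rho>}) \<le> 2 * \<rho> + 1" using k by linarith
qed

text \<open>The entries are chosen in turn: at least \<open>r\<close> choices for \<open>x\<close>,
  then at least \<open>r / 2\<close> for a \<open>y\<close> far from it, then at least
  \<open>r / 2\<close> for a \<open>z\<close> of a third colour.\<close>

lemma card_spread_triples_ge: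
  fixes M r :: real and col :: "'a \<Rightarrow> nat"
  assumes A: "finite A" "r \<le> real (card A)" and M: "M > 0" "4 * M \<le> r"
    and fib: "\<And>i. real (card {x \<in> A. col x = i}) \<le> M"
  shows "r ^ 3 / 4 \<le> real (card {(x, y, z). x \<in> A \<and> y \<in> A \<and> z \<in> A \<and>
    r / (8 * M) \<le> \<bar>real (col x) - real (col y)\<bar> \<and> col z \<noteq> col x \<and> col z \<noteq> col y})"
proof -
  \<comment> \<open>At most \<open>2 * \<rho> + 1\<close> colours lie within \<open>\<rho>\<close>
    of a given one, and they carry at most \<open>M * (2 * \<rho> + 1) = r / 4 + M\<close> elements,
    which is at most \<open>r / 2\<close>.\<close>
  define \<rho> where "\<rho> = r / (8 * M)"
  have \<rho>: "\<rho> > 0" using M by (simp add: \<rho>_def)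
  have r: "r > 0" using M by simp
  define Y where "Y x = {y \<in> A. \<rho> \<le> \<bar>real (col x) - real (col y)\<bar>}" for x
  define Z where "Z x y = {z \<in> A. col z \<noteq> col x \<and> col z \<noteq> col y}" for x y
  have Y: "real (card (Y x)) \<ge> r / 2" if "x \<in> A" for x
  proof -
    let ?B = "{y \<in> A. \<bar>real (col x) - real (col y)\<bar> < \<rho>}"
    have "card A = card (Y x \<union> ?B)" by (rule arg_cong[of _ _ card]) (auto simp: Y_def)
    also have "\<dots> \<le> card (Y x) + card ?B" by (rule card_Un_le)
    finally have 1: "real (card A) \<le> real (card (Y x)) + real (card ?B)" by linarith
    have "real (card ?B) \<le> M * real (card (col ` ?B))"
    proof (rule card_le_fibres)
      fix i
      have "card {y \<in> ?B. col y = i} \<le> card {y \<in> A. col y = i}"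
        by (rule card_mono) (use A in auto)
      then show "real (card {y \<in> ?B. col y = i}) \<le> M" using fib[of i] by linarith
    qed (use A in auto)
    also have "real (card (col ` ?B)) \<le> real (card {l. \<bar>real (col x) - real l\<bar> < \<rho>})"
      unfolding of_nat_le_iff by (rule card_mono[OF card_near_le(1)[OF \<rho>]]) auto
    also have "\<dots> \<le> 2 * \<rho> + 1" by (rule card_near_le(2)[OF \<rho>])
    also have "M * (2 * \<rho> + 1) = r / 4 + M" using M by (simp add: \<rho>_def field_simps)
    finally show ?thesis using 1 A M by simp
  qed
  \<comment> \<open>Two forbidden colours remove at most \<open>2 * M\<close> elements, again at
    most \<open>r / 2\<close>.\<close>
  have Z: "real (card (Z x y)) \<ge> r / 2" for x y
  proof -
    have "card A = card (Z x y \<union> ({z \<in> A. col z = col x} \<union> {z \<in> A. col z = col y}))"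
      by (rule arg_cong[of _ _ card]) (auto simp: Z_def)
    also have "\<dots> \<le> card (Z x y) + (card {z \<in> A. col z = col x} + card {z \<in> A. col z = col y})"
      by (intro order.trans[OF card_Un_le] add_mono order.refl card_Un_le)
    finally show ?thesis using A M fib[of "col x"] fib[of "col y"] by linarith
  qed
  have fin: "finite (Y x)" "finite (Z x y)" for x y using A by (auto simp: Y_def Z_def)
  have "r ^ 3 / 4 = r * (r / 2 * (r / 2))" by (simp add: power3_eq_cube)
  also have "\<dots> \<le> (\<Sum>x\<in>A. r / 2 * (r / 2))"
    using A by (auto intro!: mult_right_mono)
  also have "\<dots> \<le> (\<Sum>x\<in>A. \<Sum>y\<in>Y x. r / 2)"
    by (rule sum_mono) (use Y r in \<open>auto intro!: mult_right_mono\<close>)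
  also have "\<dots> \<le> (\<Sum>x\<in>A. \<Sum>y\<in>Y x. real (card (Z x y)))"
    by (intro sum_mono Z)
  also have "\<dots> = real (card (SIGMA x:A. SIGMA y:Y x. Z x y))"
    using A fin by (simp add: card_SigmaI)
  also have "(SIGMA x:A. SIGMA y:Y x. Z x y) = {(x, y, z). x \<in> A \<and> y \<in> A \<and> z \<in> A \<and>
    r / (8 * M) \<le> \<bar>real (col x) - real (col y)\<bar> \<and> col z \<noteq> col x \<and> col z \<noteq> col y}"
    by (auto simp: Y_def Z_def \<rho>_def)
  finally show ?thesis .
qed

text \<open>Incidences between cubes and spread triples are counted twice. Each cube sees at least
  \<open>r ^ 3 / 4\<close> spread triples, while the cubes seen by one triple are bounded by
  \<open>triple\<close>. In the sum over triples \<open>x\<close> ranges over all of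
  \<open>A\<close>, whereas \<open>y\<close> and \<open>z\<close> are replaced by their colours at a
  cost of \<open>N\<close> each.\<close>

lemma card_rich_le:
  fixes M L r N :: real and col :: "'a \<Rightarrow> nat" and meets :: "'b \<Rightarrow> 'a \<Rightarrow> bool"
  assumes fin: "finite A" "finite Q" and M: "M > 0" "4 * M \<le> r" and L: "L \<ge> 0"
    and col: "\<And>x. x \<in> A \<Longrightarrow> col x < n"
    and N: "\<And>i. real (card {x \<in> A. col x = i}) \<le> N"
    and fib: "\<And>q i. q \<in> Q \<Longrightarrow> real (card {x \<in> A. meets q x \<and> col x = i}) \<le> M"
    and rich: "\<And>q. q \<in> Q \<Longrightarrow> r \<le> real (card {x \<in> A. meets q x})"
    and triple: "\<And>x y z. \<lbrakk>x \<in> A; y \<in> A; z \<in> A; col x \<noteq> col y; col z \<noteq> col x; col z \<noteq> col y\<rbrakk> \<Longrightarrow>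
      real (card {q \<in> Q. meets q x \<and> meets q y \<and> meets q z}) \<le>
      L / (\<bar>real (col x) - real (col z)\<bar> * \<bar>real (col z) - real (col y)\<bar> * \<bar>real (col x) - real (col y)\<bar>)"
  shows "real (card Q) * r ^ 4 \<le> 256 * M * L * harm n ^ 2 * (real (card A) * N ^ 2)"
proof -
  define \<rho> where "\<rho> = r / (8 * M)"
  have \<rho>: "\<rho> > 0" using M by (simp add: \<rho>_def)
  have r: "r > 0" using M by simp
  have N0: "N \<ge> 0" using N[of 0] by (rule order.trans[rotated]) simp
  define w where "w i l k = 1 / (\<bar>real i - real k\<bar> * \<bar>real k - real l\<bar> * \<bar>real i - real l\<bar>)" for i l k
  define Y where "Y i = {l\<in>{..<n}. \<rho> \<le> \<bar>real i - real l\<bar>}" for i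
  \<comment> \<open>The three colours of a triple in \<open>T\<close> are distinct, because
    \<open>\<rho> > 0\<close> separates the first two; so no factor of the Vandermonde product
    vanishes.\<close>
  define T where "T = (SIGMA x:A. SIGMA y:{y\<in>A. col y \<in> Y (col x)}. {z\<in>A. col z \<in> {..<n} - {col x, col y}})"
  define R where "R q t = (case t of (x,y,z) \<Rightarrow> meets q x \<and> meets q y \<and> meets q z)" for q t
  have finT: "finite T" using fin unfolding T_def by auto
  have w0: "w i l k \<ge> 0" for i l k by (simp add: w_def)
  have "real (card Q) * (r ^ 3 / 4) \<le> (\<Sum>q\<in>Q. real (card {t\<in>T. R q t}))"
  proof (rule sum_bounded_below)
    fix q assume q: "q \<in> Q"
    have "r ^ 3 / 4 \<le> real (card {(x, y, z). x \<in> {x \<in> A. meets q x} \<and> y \<in> {x \<in> A. meets q x}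
      \<and> z \<in> {x \<in> A. meets q x} \<and>
      r / (8 * M) \<le> \<bar>real (col x) - real (col y)\<bar> \<and> col z \<noteq> col x \<and> col z \<noteq> col y})"
      using fin rich[OF q] fib[OF q] M by (intro card_spread_triples_ge) (auto simp: conj_assoc)
    also have "{(x, y, z). x \<in> {x \<in> A. meets q x} \<and> y \<in> {x \<in> A. meets q x}
      \<and> z \<in> {x \<in> A. meets q x} \<and>
      r / (8 * M) \<le> \<bar>real (col x) - real (col y)\<bar> \<and> col z \<noteq> col x \<and> col z \<noteq> col y}
      = {t\<in>T. R q t}"
      using col by (auto simp: T_def R_def Y_def \<rho>_def)
    finally show "r ^ 3 / 4 \<le> real (card {t\<in>T. R q t})" .
  qed
  also have "\<dots> = (\<Sum>t\<in>T. real (card {q\<in>Q. R q t}))"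
    using sum.swap_restrict[OF fin(2) finT, of "\<lambda>_ _. 1::real" R] by simp
  also have "\<dots> \<le> (\<Sum>(x,y,z)\<in>T. L * w (col x) (col y) (col z))"
  proof (rule sum_mono, clarify)
    fix x y z assume t: "(x,y,z) \<in> T"
    then show "real (card {q\<in>Q. R q (x,y,z)}) \<le> L * w (col x) (col y) (col z)"
      using triple[of x y z] \<rho> by (auto simp: T_def R_def w_def Y_def)
  qed
  also have "\<dots> = (\<Sum>x\<in>A. \<Sum>y\<in>{y\<in>A. col y \<in> Y (col x)}.
      \<Sum>z\<in>{z\<in>A. col z \<in> {..<n} - {col x, col y}}. L * w (col x) (col y) (col z))"
    unfolding T_def using fin by (simp add: sum.Sigma case_prod_unfold)
  also have "\<dots> \<le> (\<Sum>x\<in>A. N ^ 2 * L * (8 * harm n ^ 2 / \<rho>))"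
  proof (rule sum_mono)
    fix x assume x: "x \<in> A"
    let ?V = "\<lambda>l. {..<n} - {col x, l}"
    have cl: "real (card {z \<in> {z\<in>A. col z \<in> P}. col z = i}) \<le> N" for P i
      by (rule order.trans[OF _ N[of i]], unfold of_nat_le_iff, rule card_mono) (use fin in auto)
    have "(\<Sum>y\<in>{y\<in>A. col y \<in> Y (col x)}. \<Sum>z\<in>{z\<in>A. col z \<in> ?V (col y)}. L * w (col x) (col y) (col z))
      \<le> (\<Sum>y\<in>{y\<in>A. col y \<in> Y (col x)}. N * (\<Sum>k\<in>?V (col y). L * w (col x) (col y) k))"
      by (intro sum_mono sum_fibres_le cl) (use fin L w0 in auto)
    also have "\<dots> \<le> N * (\<Sum>l\<in>Y (col x). N * (\<Sum>k\<in>?V l. L * w (col x) l k))"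
      by (intro sum_fibres_le[where g = "\<lambda>l. N * (\<Sum>k\<in>?V l. L * w (col x) l k)"] cl)
        (use fin L w0 N0 in \<open>auto simp: Y_def intro!: mult_nonneg_nonneg sum_nonneg\<close>)
    also have "\<dots> = N ^ 2 * L * (\<Sum>l\<in>Y (col x). \<Sum>k\<in>?V l. w (col x) l k)"
      by (simp add: sum_distrib_left power2_eq_square mult_ac)
    also have "\<dots> \<le> N ^ 2 * L * (8 * harm n ^ 2 / \<rho>)"
      unfolding Y_def w_def
      by (intro mult_left_mono sum_inverse_vandermonde_le col x \<rho>) (use L in auto)
    finally show "(\<Sum>y\<in>{y\<in>A. col y \<in> Y (col x)}. \<Sum>z\<in>{z\<in>A. col z \<in> ?V (col y)}. L * w (col x) (col y) (col z))
      \<le> N ^ 2 * L * (8 * harm n ^ 2 / \<rho>)" .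
  qed
  finally have "real (card Q) * (r ^ 3 / 4) \<le> real (card A) * (N ^ 2 * L * (8 * harm n ^ 2 / \<rho>))"
    by simp
  \<comment> \<open>As \<open>1 / \<rho> = 8 * M / r\<close>, the separation gains the fourth power
    of \<open>r\<close>, and the constant becomes \<open>8 * 8 * 4 = 256\<close>.\<close>
  then have "real (card Q) * (r ^ 3 / 4) * (4 * r) \<le> real (card A) * (N ^ 2 * L * (8 * harm n ^ 2 / \<rho>)) * (4 * r)"
    using r by (intro mult_right_mono) auto
  then show ?thesis using M r by (simp add: \<rho>_def field_simps eval_nat_numeral)
qed

section \<open>Plates and cubes\<close>

text \<open>Volumes are compared after applying \<open>f\<close>, which scales them by the
  determinant. A measurable core \<open>B q\<close> stands in for each \<open>q\<close>, and the
  bound is first shown for finite subfamilies; being uniform, it forces \<open>Q\<close> to be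
  finite.\<close>

lemma linear_packing:
  fixes f :: "real^3 \<Rightarrow> real^3"
  assumes f: "linear f" and disj: "pairwise (\<lambda>p q. disjnt (B p) (B q)) Q"
    and B: "\<And>q. q \<in> Q \<Longrightarrow> B q \<in> lmeasurable \<and> \<mu> \<le> measure lebesgue (B q) \<and> f ` B q \<subseteq> cbox a b"
    and \<mu>: "\<mu> > 0" and det: "det (matrix f) \<noteq> 0"
  shows "finite Q \<and> real (card Q) \<le> measure lebesgue (cbox a b) / (\<bar>det (matrix f)\<bar> * \<mu>)"
proof -
  define W where "W = measure lebesgue (cbox a b) / (\<bar>det (matrix f)\<bar> * \<mu>)"
  have bd: "real (card F) \<le> W" if F: "F \<subseteq> Q" "finite F" for F
  proof -
    have meas: "(\<Union>q\<in>F. B q) \<in> lmeasurable" using F B by (intro fmeasurable.finite_UN) auto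
    have "real (card F) * \<mu> \<le> (\<Sum>q\<in>F. measure lebesgue (B q))"
      by (rule sum_bounded_below) (use F B in auto)
    also have "\<dots> = measure lebesgue (\<Union>q\<in>F. B q)"
      by (rule measure_UNION'[symmetric]) (use F B pairwise_subset[OF disj] in auto)
    finally have "\<bar>det (matrix f)\<bar> * (real (card F) * \<mu>) \<le> \<bar>det (matrix f)\<bar> * measure lebesgue (\<Union>q\<in>F. B q)"
      by (rule mult_left_mono) simp
    also have "\<dots> = measure lebesgue (f ` (\<Union>q\<in>F. B q))"
      by (rule measure_linear_image[OF f meas, symmetric])
    also have "\<dots> \<le> measure lebesgue (cbox a b)"
      by (rule measure_mono_fmeasurable)
        (use F B measurable_linear_image[OF f meas] in \<open>auto simp: fmeasurableD\<close>)
    finally show ?thesis using \<mu> det by (simp add: W_def field_simps)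
  qed
  have "finite Q \<and> card Q \<le> nat \<lfloor>W\<rfloor>"
    by (rule finite_if_finite_subsets_card_bdd) (use bd le_nat_floor in blast)
  then show ?thesis using bd unfolding W_def by blast
qed

text \<open>The matrix with rows \<open>e i\<close> is orthogonal, so it preserves the norm, and the
  l1 bound applies to the rotated vector.\<close>

lemma norm_le_orthonormal_frame:
  assumes "orthonormal_frame e"
  shows "norm z \<le> (\<Sum>i\<in>UNIV. \<bar>z \<bullet> e i\<bar>)"
proof -
  define A :: "real^3^3" where "A = (\<chi> i. e i)"
  have "orthogonal_matrix A"
    using assms unfolding orthogonal_matrix_orthonormal_rows
    by (auto simp: A_def row_def orthonormal_frame_def orthogonal_def norm_eq_1)
  then have "orthogonal_transformation ((*v) A)"
    by (simp add: orthogonal_transformation_matrix)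
  then have "norm z = norm (A *v z)" by (simp add: orthogonal_transformation_norm)
  also have "\<dots> \<le> (\<Sum>i\<in>UNIV. \<bar>(A *v z) $ i\<bar>)" by (rule norm_le_l1_cart)
  also have "\<dots> = (\<Sum>i\<in>UNIV. \<bar>z \<bullet> e i\<bar>)"
    by (simp add: matrix_vector_mul_component A_def inner_commute)
  finally show ?thesis .
qed

lemma norm_frame: "orthonormal_frame e \<Longrightarrow> norm (e i) = 1"
  by (simp add: orthonormal_frame_def norm_eq_1)

text \<open>Provides an axis-parallel core whose volume is known, whatever the rotation of
  \<open>q\<close>. Points of the core are within \<open>3 * (s / 8) < s / 2\<close> of the centre,
  hence within the open cube in every frame direction.\<close>

lemma cube_core:
  assumes q: "is_cube s q"
  obtains y where "cbox (y - vec (s / 8)) (y + vec (s / 8)) \<subseteq> q"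
    and "\<And>x. x \<in> q \<Longrightarrow> norm (x - y) \<le> 3 / 2 * s"
proof -
  from q obtain p e where e: "orthonormal_frame e" and s: "s > 0"
    and lo: "open_rect_box p e (vec s) \<subseteq> q" and hi: "q \<subseteq> rect_box p e (vec s)"
    by (auto simp: is_cube_def)
  show thesis
  proof
    show "cbox (p - vec (s / 8)) (p + vec (s / 8)) \<subseteq> q"
    proof (rule order.trans[OF _ lo], rule subsetI)
      fix x assume x: "x \<in> cbox (p - vec (s / 8)) (p + vec (s / 8))"
      have "norm (x - p) \<le> (\<Sum>i\<in>UNIV. \<bar>(x - p) $ i\<bar>)" by (rule norm_le_l1_cart)
      also have "\<dots> \<le> (\<Sum>i\<in>(UNIV::3 set). s / 8)"
      proof (rule sum_mono)
        fix i :: 3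
        have "p $ i - s / 8 \<le> x $ i \<and> x $ i \<le> p $ i + s / 8" using x by (simp add: mem_box_cart)
        then show "\<bar>(x - p) $ i\<bar> \<le> s / 8" unfolding vector_minus_component abs_le_iff by linarith
      qed
      also have "\<dots> < s / 2" using s by simp
      finally have "norm (x - p) < s / 2" .
      moreover have "\<bar>(x - p) \<bullet> e i\<bar> \<le> norm (x - p)" for i
        using Cauchy_Schwarz_ineq2[of "x - p" "e i"] norm_frame[OF e] by simp
      ultimately have "\<bar>(x - p) \<bullet> e i\<bar> < s / 2" for i by (rule le_less_trans[rotated])
      then show "x \<in> open_rect_box p e (vec s)" by (simp add: open_rect_box_def)
    qed
    fix x assume "x \<in> q"
    then have x: "\<bar>(x - p) \<bullet> e i\<bar> \<le> s / 2" for i using hi by (auto simp: rect_box_def)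
    have "norm (x - p) \<le> (\<Sum>i\<in>UNIV. \<bar>(x - p) \<bullet> e i\<bar>)" by (rule norm_le_orthonormal_frame[OF e])
    also have "\<dots> \<le> (\<Sum>i\<in>(UNIV::3 set). s / 2)" by (rule sum_mono) (rule x)
    finally show "norm (x - p) \<le> 3 / 2 * s" by simp
  qed
qed

section \<open>Tangent vectors and the slabs around plates\<close>

text \<open>Left unnormalised so that determinants of three of these are polynomial; on
  \<open>[0,1]\<close> the length lies between 1 and 4, so only constants change.\<close>

definition tangent :: "real \<Rightarrow> real^3" where
  "tangent c = vector [1, 2 * c, 3 * c^2]"

lemma tangent_inner: "x \<bullet> tangent c = x $ 1 + 2 * c * x $ 2 + 3 * c^2 * x $ 3"
  by (simp add: inner_vec_def tangent_def sum_3)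

lemma norm_tangent:
  assumes "0 \<le> c" "c \<le> 1"
  shows "1 \<le> norm (tangent c)" "norm (tangent c) \<le> 4"
proof -
  have eq: "norm (tangent c) ^ 2 = 1 + 4 * c^2 + 9 * c^4"
    by (simp add: power2_norm_eq_inner tangent_inner) (simp add: tangent_def algebra_simps eval_nat_numeral)
  have "c ^ 2 \<le> 1" "c ^ 4 \<le> 1" using assms by (auto intro: power_le_one)
  then have le: "1 ^ 2 \<le> norm (tangent c) ^ 2" "norm (tangent c) ^ 2 \<le> 4 ^ 2"
    unfolding eq using zero_le_power2[of c] zero_le_power[OF assms(1), of 4] by simp_all
  show "1 \<le> norm (tangent c)" by (rule power2_le_imp_le[OF le(1)]) simp
  show "norm (tangent c) \<le> 4" by (rule power2_le_imp_le[OF le(2)]) simp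
qed

lemma vector_derivative_moment_curve: "vector_derivative moment_curve (at t) = tangent t"
proof (rule vector_derivative_at)
  have eq: "vector [a, b, c] = a *\<^sub>R axis 1 1 + b *\<^sub>R axis 2 1 + c *\<^sub>R (axis 3 1 :: real^3)" for a b c
    by (simp add: vec_eq_iff forall_3 axis_def)
  show "(moment_curve has_vector_derivative tangent t) (at t)"
    unfolding moment_curve_def[abs_def] tangent_def eq
    by (auto intro!: derivative_eq_intros)
qed

text \<open>Only the short direction \<open>e 1\<close> of a plate is prescribed, so plates of one
  interval may have different frames. The inner region is therefore described in coordinates that
  are the same for all plates of that interval, which makes their centres comparable.\<close>

lemma plate_slab:
  fixes K \<delta> :: real
  assumes K: "K \<ge> 1" and \<delta>: "0 < \<delta>" "\<delta> < 1" and c: "0 \<le> Inf I" "Inf I \<le> 1"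
    and S: "vinogradov_plate K \<delta> I S"
  obtains p where "p \<in> S" "\<And>x. x \<in> S \<Longrightarrow> \<bar>(x - p) \<bullet> tangent (Inf I)\<bar> \<le> 2 * K / \<delta>"
    and "\<And>x. \<bar>(x - p) $ 2\<bar> \<le> 1 / (16 * K * \<delta>^2) \<Longrightarrow> \<bar>(x - p) $ 3\<bar> \<le> 1 / (16 * K * \<delta>^2) \<Longrightarrow>
        \<bar>(x - p) \<bullet> tangent (Inf I)\<bar> \<le> 1 / (16 * K * \<delta>) \<Longrightarrow> x \<in> S"
proof -
  let ?v = "tangent (Inf I)"
  define t where "t = norm ?v"
  have t: "1 \<le> t" "t \<le> 4" unfolding t_def using norm_tangent[OF c] by auto
  from S obtain p e where e: "orthonormal_frame e" and e1: "e 1 = unit_tangent I"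
    and lo: "rect_box p e ((1 / K) *\<^sub>R plate_dims \<delta>) \<subseteq> S"
    and hi: "S \<subseteq> rect_box p e (K *\<^sub>R plate_dims \<delta>)"
    by (auto simp: vinogradov_plate_def)
  have e1: "x \<bullet> e 1 = (x \<bullet> ?v) / t" for x
    by (simp add: e1 unit_tangent_def vector_derivative_moment_curve sgn_div_norm t_def divide_inverse)
  have \<delta>2: "1 / \<delta> \<le> 1 / \<delta>^2" using \<delta> by (simp add: field_simps power2_eq_square)
  show thesis
  proof
    have "p \<in> rect_box p e ((1 / K) *\<^sub>R plate_dims \<delta>)"
      using K \<delta> by (simp add: rect_box_def forall_3 plate_dims_def)
    then show "p \<in> S" using lo by blast
    show "\<bar>(x - p) \<bullet> ?v\<bar> \<le> 2 * K / \<delta>" if "x \<in> S" for x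
    proof -
      have "x \<in> rect_box p e (K *\<^sub>R plate_dims \<delta>)" using that hi by blast
      then have "\<bar>(x - p) \<bullet> e 1\<bar> \<le> K / \<delta> / 2"
        by (auto simp: rect_box_def forall_3 plate_dims_def)
      then have "\<bar>(x - p) \<bullet> ?v\<bar> / t \<le> K / \<delta> / 2" using t unfolding e1 by (simp add: abs_divide)
      then have "\<bar>(x - p) \<bullet> ?v\<bar> \<le> K / \<delta> / 2 * t" using t by (simp add: field_simps)
      also have "\<dots> \<le> K / \<delta> / 2 * 4" by (rule mult_left_mono) (use K \<delta> t in auto)
      finally show ?thesis by simp
    qed
    fix x assume x: "\<bar>(x - p) $ 2\<bar> \<le> 1 / (16 * K * \<delta>^2)" "\<bar>(x - p) $ 3\<bar> \<le> 1 / (16 * K * \<delta>^2)"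
        "\<bar>(x - p) \<bullet> ?v\<bar> \<le> 1 / (16 * K * \<delta>)"
    define z where "z = x - p"
    \<comment> \<open>The first coordinate of \<open>z\<close> is at most
      \<open>h + 2 * h + 3 * h\<close>, so \<open>norm z \<le> 8 * h\<close>, which is exactly half
      a long edge of the inner box. This is the source of 16.\<close>
    define h where "h = 1 / (16 * K * \<delta>^2)"
    have h0: "h \<ge> 0" using K by (simp add: h_def)
    have h1: "1 / (16 * K * \<delta>) \<le> h" using K \<delta> by (simp add: h_def field_simps power2_eq_square)
    note x = x[folded z_def h_def]
    have c2: "(Inf I)^2 \<le> 1" using c by (simp add: power_le_one)
    have "\<bar>z $ 1\<bar> = \<bar>z \<bullet> ?v - 2 * Inf I * z $ 2 - 3 * (Inf I)^2 * z $ 3\<bar>" by (simp add: tangent_inner)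
    also have "\<dots> \<le> \<bar>z \<bullet> ?v\<bar> + \<bar>2 * Inf I * z $ 2\<bar> + \<bar>3 * (Inf I)^2 * z $ 3\<bar>" by linarith
    finally have z1: "\<bar>z $ 1\<bar> \<le> \<bar>z \<bullet> ?v\<bar> + \<bar>2 * Inf I * z $ 2\<bar> + \<bar>3 * (Inf I)^2 * z $ 3\<bar>" .
    have "\<bar>2 * Inf I * z $ 2\<bar> \<le> 2 * h"
      using mult_mono[of "Inf I" 1 "\<bar>z $ 2\<bar>" h] x c by (simp add: abs_mult)
    moreover have "\<bar>3 * (Inf I)^2 * z $ 3\<bar> \<le> 3 * h"
      using mult_mono[of "(Inf I)^2" 1 "\<bar>z $ 3\<bar>" h] x c2 by (simp add: abs_mult)
    ultimately have "\<bar>z $ 1\<bar> \<le> 6 * h" using x(3) h1 z1 by linarith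
    then have "norm z \<le> 8 * h" using norm_le_l1_cart[of z] x by (simp add: sum_3)
    then have "\<bar>z \<bullet> e i\<bar> \<le> 8 * h" for i
      using Cauchy_Schwarz_ineq2[of z "e i"] norm_frame[OF e, of i] by simp
    moreover have "8 * h = 1 / K * (1 / \<delta>^2) / 2" using K \<delta> by (simp add: h_def field_simps)
    moreover have "\<bar>z \<bullet> e 1\<bar> \<le> 1 / K * (1 / \<delta>) / 2"
    proof -
      have "\<bar>z \<bullet> e 1\<bar> \<le> \<bar>z \<bullet> ?v\<bar>"
        using divide_left_mono[of 1 t "\<bar>z \<bullet> ?v\<bar>"] t unfolding e1 by (simp add: abs_divide)
      also have "\<dots> \<le> 1 / (16 * K * \<delta>)" by (rule x)
      also have "\<dots> \<le> 1 / K * (1 / \<delta>) / 2" using K \<delta> by (simp add: field_simps)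
      finally show ?thesis .
    qed
    ultimately have "x \<in> rect_box p e ((1 / K) *\<^sub>R plate_dims \<delta>)"
      by (simp add: rect_box_def forall_3 plate_dims_def z_def mult_ac)
    then show "x \<in> S" using lo by blast
  qed
qed

section \<open>The Vandermonde determinant and packing of disjoint cubes\<close>

text \<open>The rows are \<open>(1, 2a, 3a^2)\<close> and its analogues: a Vandermonde matrix with
  columns scaled by 1, 2 and 3, whence the factor 6.\<close>

lemma det_tangents:
  fixes f :: "real^3 \<Rightarrow> real^3"
  assumes f: "f = (\<lambda>z. vector [z \<bullet> tangent a, z \<bullet> tangent b, z \<bullet> tangent c])"
  shows "linear f" "det (matrix f) = 6 * (b - a) * (c - b) * (c - a)"
proof -
  show "linear f"
    unfolding f by (rule linearI) (auto simp: vec_eq_iff forall_3 inner_add_left)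
  have "matrix f = vector [tangent a, tangent b, tangent c]"
    by (simp add: vec_eq_iff forall_3 matrix_def f inner_commute[of "axis _ 1"] cart_eq_inner_axis[symmetric])
  then show "det (matrix f) = 6 * (b - a) * (c - b) * (c - a)"
    by (simp add: det_3 tangent_def) (simp add: algebra_simps power2_eq_square)
qed

lemma measure_cbox_cube: "h \<ge> 0 \<Longrightarrow> measure lebesgue (cbox (y - vec h) (y + vec h :: real^3)) = (2 * h) ^ 3"
proof -
  assume h: "h \<ge> 0"
  then have "cbox (y - vec h) (y + vec h) \<noteq> {}"
    by (auto simp: interval_ne_empty_cart)
  then show ?thesis by (simp add: content_cbox_cart measure_completion prod_constant)
qed

text \<open>Cores have side \<open>s / 4\<close>, at least \<open>1 / (4 * K * \<delta>)\<close>,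
  and their images lie in a cube of side \<open>2 * h\<close>; the ratio of sides is
  \<open>8 * K * \<delta> * h\<close>. The map \<open>f\<close> is general because both the identity
  and the triple of tangent functionals are needed.\<close>

lemma disjoint_cubes_packing:
  fixes f :: "real^3 \<Rightarrow> real^3"
  assumes K: "K \<ge> 1" and \<delta>: "0 < \<delta>" and Q: "disjoint Q"
    and cube: "\<And>q. q \<in> Q \<Longrightarrow> \<exists>s. is_cube s q \<and> 1 / (K * \<delta>) \<le> s"
    and f: "linear f" "det (matrix f) \<noteq> 0" and h: "h \<ge> 0"
    and im: "\<And>q x i. q \<in> Q \<Longrightarrow> x \<in> q \<Longrightarrow> \<bar>f x $ i - a $ i\<bar> \<le> h"
  shows "finite Q \<and> real (card Q) \<le> (8 * K * \<delta> * h) ^ 3 / \<bar>det (matrix f)\<bar>"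
proof -
  define \<mu> where "\<mu> = (1 / (4 * K * \<delta>)) ^ 3"
  have "\<exists>B. B \<subseteq> q \<and> B \<in> lmeasurable \<and> \<mu> \<le> measure lebesgue B" if q: "q \<in> Q" for q
  proof -
    obtain s where s: "is_cube s q" "1 / (K * \<delta>) \<le> s" using cube[OF q] by blast
    obtain y where y: "cbox (y - vec (s / 8)) (y + vec (s / 8)) \<subseteq> q" using cube_core[OF s(1)] by blast
    have "s > 0" using s by (simp add: is_cube_def)
    then have "measure lebesgue (cbox (y - vec (s / 8)) (y + vec (s / 8))) = (s / 4) ^ 3"
      using measure_cbox_cube[of "s / 8" y] by simp
    moreover have "\<mu> \<le> (s / 4) ^ 3"
      unfolding \<mu>_def by (rule power_mono) (use s K \<delta> in \<open>auto simp: field_simps\<close>)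
    ultimately show ?thesis using y by (metis lmeasurable_cbox)
  qed
  then obtain B where B: "\<And>q. q \<in> Q \<Longrightarrow> B q \<subseteq> q \<and> B q \<in> lmeasurable \<and> \<mu> \<le> measure lebesgue (B q)"
    by metis
  have "finite Q \<and> real (card Q) \<le> measure lebesgue (cbox (a - vec h) (a + vec h)) / (\<bar>det (matrix f)\<bar> * \<mu>)"
  proof (rule linear_packing[OF f(1) _ _ _ f(2)])
    show "pairwise (\<lambda>p q. disjnt (B p) (B q)) Q"
      using Q B unfolding pairwise_def disjnt_def disjoint_def by blast
    show "B q \<in> lmeasurable \<and> \<mu> \<le> measure lebesgue (B q) \<and> f ` B q \<subseteq> cbox (a - vec h) (a + vec h)"
      if "q \<in> Q" for q
    proof -
      have "f x \<in> cbox (a - vec h) (a + vec h)" if "x \<in> B q" for x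
      proof -
        have "\<bar>f x $ i - a $ i\<bar> \<le> h" for i using im B \<open>q \<in> Q\<close> that by blast
        then show ?thesis by (auto simp: mem_box_cart abs_le_iff algebra_simps)
      qed
      then show ?thesis using B[OF that] by auto
    qed
    show "\<mu> > 0" using K \<delta> by (simp add: \<mu>_def)
  qed
  also have "measure lebesgue (cbox (a - vec h) (a + vec h)) / (\<bar>det (matrix f)\<bar> * \<mu>)
      = (8 * K * \<delta> * h) ^ 3 / \<bar>det (matrix f)\<bar>"
    unfolding measure_cbox_cube[OF h] \<mu>_def using K \<delta> f by (simp add: field_simps)
  finally show ?thesis .
qed

section \<open>Interval indices as colours, and bounded overlap at a cube\<close>

text \<open>For \<open>I \<in> intervals \<delta>\<close> the quotient is already a natural number;
  the floor only converts its type.\<close>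

definition col_index :: "real \<Rightarrow> real set \<Rightarrow> nat" where
  "col_index \<delta> I = nat \<lfloor>Inf I / \<delta>\<rfloor>"

lemma col_index_interval:
  assumes "\<delta> > 0" "I \<in> intervals \<delta>"
  shows "I = {real (col_index \<delta> I) * \<delta>..real (col_index \<delta> I) * \<delta> + \<delta>}"
    and "Inf I = real (col_index \<delta> I) * \<delta>" and "real (col_index \<delta> I) * \<delta> < 1"
proof -
  from assms obtain j :: nat where I: "I = {real j * \<delta>..real j * \<delta> + \<delta>}" and j: "real j * \<delta> < 1"
    by (auto simp: intervals_def)
  have inf: "Inf I = real j * \<delta>" using assms by (simp add: I)
  then have "col_index \<delta> I = j" using assms by (simp add: col_index_def)
  with I j inf show "I = {real (col_index \<delta> I) * \<delta>..real (col_index \<delta> I) * \<delta> + \<delta>}"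
    "Inf I = real (col_index \<delta> I) * \<delta>" "real (col_index \<delta> I) * \<delta> < 1" by simp_all
qed

lemma col_index_eq_iff:
  "\<delta> > 0 \<Longrightarrow> I \<in> intervals \<delta> \<Longrightarrow> J \<in> intervals \<delta> \<Longrightarrow> col_index \<delta> I = col_index \<delta> J \<longleftrightarrow> I = J"
  using col_index_interval(1)[of \<delta> I] col_index_interval(1)[of \<delta> J] by metis

lemma floor_eq_imp_close:
  fixes x y h :: real
  assumes "\<lfloor>x * h\<rfloor> = \<lfloor>y * h\<rfloor>" "h > 0"
  shows "\<bar>x - y\<bar> \<le> 1 / h"
proof -
  have "\<bar>(x - y) * h\<bar> \<le> 1" using assms unfolding left_diff_distrib by linarith
  then have "\<bar>x - y\<bar> * h \<le> 1" using assms by (simp add: abs_mult)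
  then show ?thesis using assms by (simp add: pos_le_divide_eq)
qed

text \<open>Separation allows \<open>K\<close> plates per rounding class, and each of three rounded
  coordinates takes at most \<open>2 * (320 * K^2) + 3\<close> values.\<close>

definition overlap_const :: "real \<Rightarrow> real" where
  "overlap_const K = K * (2 * (320 * K^2) + 3) ^ 3"

lemma inner_tangent_le:
  assumes "0 \<le> c" "c \<le> 1" "norm (x - y) \<le> b"
  shows "\<bar>(x - y) \<bullet> tangent c\<bar> \<le> 4 * b"
proof -
  have "\<bar>(x - y) \<bullet> tangent c\<bar> \<le> norm (x - y) * norm (tangent c)" by (rule Cauchy_Schwarz_ineq2)
  also have "\<dots> \<le> b * 4"
    using assms norm_tangent[OF assms(1,2)] norm_ge_zero[of "x - y"] by (intro mult_mono) linarith+
  finally show ?thesis by simp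
qed

text \<open>Rounding the coordinates of the plate centres sorts the plates into \<open>O(1)\<close> classes such that all
  plates of a class contain the centre of any one of them.\<close>

lemma plates_meeting_cube_le:
  fixes K \<delta> :: real
  assumes K: "K \<ge> 1" and \<delta>: "0 < \<delta>" "\<delta> < 1"
    and S: "plate_collection K \<delta> \<S>" "separated K \<delta> \<S>" and I: "I \<in> intervals \<delta>"
    and q: "\<And>x x'. x \<in> q \<Longrightarrow> x' \<in> q \<Longrightarrow> norm (x - x') \<le> 3 * K / \<delta>"
  shows "real (card {S \<in> plates_of \<S> I. S \<inter> q \<noteq> {}}) \<le> overlap_const K"
proof (cases "q = {}")
  case True
  then show ?thesis using K by (simp add: overlap_const_def)
next
  case False
  then obtain y where y: "y \<in> q" by blast
  define v where "v = tangent (Inf I)"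
  define A where "A = {S \<in> plates_of \<S> I. S \<inter> q \<noteq> {}}"
  have c: "0 \<le> Inf I" "Inf I \<le> 1" using col_index_interval[OF \<delta>(1) I] \<delta> by auto
  have plate: "vinogradov_plate K \<delta> I S" "S \<subseteq> {x. \<forall>i. \<bar>x $ i\<bar> \<le> 1 / \<delta>^2}" if "S \<in> A" for S
    using S(1) that by (fastforce simp: A_def plates_of_def plate_collection_def)+
  have "finite (plates_of \<S> I)"
  proof (rule finite_subset)
    show "plates_of \<S> I \<subseteq> snd ` \<S>" by (force simp: plates_of_def)
  qed (use S(1) in \<open>simp add: plate_collection_def\<close>)
  then have finP: "finite (plates_of \<S> I)" and fin: "finite A" by (auto simp: A_def)
  have "\<exists>p. p \<in> S \<and> (\<forall>x\<in>S. \<bar>(x - p) \<bullet> v\<bar> \<le> 2 * K / \<delta>) \<and>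
    (\<forall>x. \<bar>(x - p) $ 2\<bar> \<le> 1 / (16 * K * \<delta>^2) \<longrightarrow> \<bar>(x - p) $ 3\<bar> \<le> 1 / (16 * K * \<delta>^2) \<longrightarrow>
        \<bar>(x - p) \<bullet> v\<bar> \<le> 1 / (16 * K * \<delta>) \<longrightarrow> x \<in> S)" if "S \<in> A" for S
    using plate_slab[OF K \<delta> c plate(1)[OF that]] unfolding v_def by metis
  then obtain p where p: "\<And>S. S \<in> A \<Longrightarrow> p S \<in> S"
    and slab: "\<And>S x. S \<in> A \<Longrightarrow> x \<in> S \<Longrightarrow> \<bar>(x - p S) \<bullet> v\<bar> \<le> 2 * K / \<delta>"
    and core: "\<And>S x. S \<in> A \<Longrightarrow> \<bar>(x - p S) $ 2\<bar> \<le> 1 / (16 * K * \<delta>^2) \<Longrightarrow>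
      \<bar>(x - p S) $ 3\<bar> \<le> 1 / (16 * K * \<delta>^2) \<Longrightarrow> \<bar>(x - p S) \<bullet> v\<bar> \<le> 1 / (16 * K * \<delta>) \<Longrightarrow> x \<in> S"
    by metis
  \<comment> \<open>The mesh sizes are those of the inner region in \<open>core\<close>. Two
    coordinates are confined by the ambient box; the third is measured from \<open>y\<close> because
    only meeting \<open>q\<close> confines it to \<open>O(1 / \<delta>)\<close>.\<close>
  define g where "g S = (\<lfloor>p S $ 2 * (16 * K * \<delta>^2)\<rfloor>, \<lfloor>p S $ 3 * (16 * K * \<delta>^2)\<rfloor>,
    \<lfloor>(p S - y) \<bullet> v * (16 * K * \<delta>)\<rfloor>)" for S
  define m where "m = \<lfloor>320 * K^2\<rfloor> + 1"
  have K2: "K \<le> K^2" using K by (simp add: power2_eq_square)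
  have m: "320 * K^2 < m" "m \<le> 320 * K^2 + 1" unfolding m_def by linarith+
  have m0: "m \<ge> 0" using m(1) K2 K by linarith
  have fl: "\<lfloor>t\<rfloor> \<in> {-m..m}" if "\<bar>t\<bar> \<le> 320 * K^2" for t using that m by (simp add: floor_le_iff le_floor_iff) linarith
  have img: "g ` A \<subseteq> {-m..m} \<times> {-m..m} \<times> {-m..m}"
  proof (rule image_subsetI)
    fix S assume SA: "S \<in> A"
    have bd: "\<bar>p S $ i * (16 * K * \<delta>^2)\<bar> \<le> 320 * K^2" for i
    proof -
      have "\<bar>p S $ i\<bar> \<le> 1 / \<delta>^2" using plate(2)[OF SA] p[OF SA] by blast
      then have "\<bar>p S $ i\<bar> * (16 * K * \<delta>^2) \<le> 1 / \<delta>^2 * (16 * K * \<delta>^2)"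
        by (rule mult_right_mono) (use K in auto)
      also have "\<dots> = 16 * K" using \<delta> by simp
      also have "16 * K \<le> 320 * K^2" using K K2 by linarith
      finally show ?thesis using K by (simp add: abs_mult)
    qed
    obtain x where x: "x \<in> S" "x \<in> q" using SA by (auto simp: A_def)
    \<comment> \<open>A point \<open>x\<close> common to \<open>S\<close> and \<open>q\<close> links
      the centre to \<open>y\<close>: the cube contributes \<open>12 * K / \<delta>\<close> and the
      slab \<open>2 * K / \<delta>\<close>.\<close>
    have "(p S - y) \<bullet> v = (x - y) \<bullet> v - (x - p S) \<bullet> v" by (simp add: inner_diff_left)
    then have "\<bar>(p S - y) \<bullet> v\<bar> \<le> 4 * (3 * K / \<delta>) + 2 * K / \<delta>"
      using inner_tangent_le[OF c q[OF x(2) y]] slab[OF SA x(1)] unfolding v_def by linarith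
    also have "\<dots> = 14 * K / \<delta>" by (simp add: field_simps)
    finally have "\<bar>(p S - y) \<bullet> v\<bar> * (16 * K * \<delta>) \<le> 14 * K / \<delta> * (16 * K * \<delta>)"
      by (rule mult_right_mono) (use K \<delta> in auto)
    also have "\<dots> = 224 * K^2" using \<delta> by (simp add: power2_eq_square)
    also have "\<dots> \<le> 320 * K^2" by simp
    finally have "\<bar>(p S - y) \<bullet> v * (16 * K * \<delta>)\<bar> \<le> 320 * K^2" using K \<delta> by (simp add: abs_mult)
    then show "g S \<in> {-m..m} \<times> {-m..m} \<times> {-m..m}" unfolding g_def by (intro SigmaI fl bd)
  qed
  have "real (card A) \<le> K * real (card (g ` A))"
  proof (rule card_le_fibres[OF fin])
    fix t assume "t \<in> g ` A"
    then obtain S0 where S0: "S0 \<in> A" "g S0 = t" by blast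
    \<comment> \<open>All plates of a class contain the single point \<open>p S0\<close>, where
      separation can be applied.\<close>
    have "p S0 \<in> S" if "S \<in> A" "g S = t" for S
    proof (rule core[OF that(1)])
      have gg: "g S0 = g S" using S0 that by simp
      show "\<bar>(p S0 - p S) $ 2\<bar> \<le> 1 / (16 * K * \<delta>^2)" "\<bar>(p S0 - p S) $ 3\<bar> \<le> 1 / (16 * K * \<delta>^2)"
        using gg K \<delta> by (auto simp: g_def intro: floor_eq_imp_close)
      have "\<bar>(p S0 - y) \<bullet> v - (p S - y) \<bullet> v\<bar> \<le> 1 / (16 * K * \<delta>)"
        by (rule floor_eq_imp_close) (use gg K \<delta> in \<open>auto simp: g_def\<close>)
      then show "\<bar>(p S0 - p S) \<bullet> v\<bar> \<le> 1 / (16 * K * \<delta>)" by (simp add: inner_diff_left)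
    qed
    then have "card {S \<in> A. g S = t} \<le> card {S \<in> plates_of \<S> I. p S0 \<in> S}"
      by (intro card_mono) (use finP in \<open>auto simp: A_def\<close>)
    moreover have "real (card {S \<in> plates_of \<S> I. p S0 \<in> S}) \<le> K"
      using S(2) I by (auto simp: separated_def)
    ultimately show "real (card {S \<in> A. g S = t}) \<le> K" by linarith
  qed
  also have "card (g ` A) \<le> card ({-m..m} \<times> {-m..m} \<times> {-m..m})"
    by (rule card_mono[OF _ img]) simp
  also have "\<dots> = nat (2 * m + 1) ^ 3" by (simp add: card_cartesian_product power3_eq_cube)
  also have "K * real (nat (2 * m + 1) ^ 3) \<le> overlap_const K"
    unfolding overlap_const_def of_nat_power
    by (intro mult_left_mono power_mono) (use m m0 K in auto)
  finally show ?thesis using K by (simp add: A_def)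
qed

text \<open>The sequence \<open>harm n - ln n\<close> decreases from its value 1 at
  \<open>n = 1\<close>.\<close>

lemma harm_le_ln: "n > 0 \<Longrightarrow> harm n \<le> ln (real n) + 1"
  using euler_mascheroni_sequence_decreasing[of 1 n] by (simp add: harm_expand)

section \<open>Counting cubes: in the ambient box, on three plates, and of given richness\<close>

lemma cube_diameter:
  assumes "is_cube s q" "s \<le> K / \<delta>" "x \<in> q" "x' \<in> q"
  shows "norm (x - x') \<le> 3 * K / \<delta>"
proof -
  obtain y where y: "\<And>x. x \<in> q \<Longrightarrow> norm (x - y) \<le> 3 / 2 * s" using cube_core[OF assms(1)] by metis
  have "norm (x - x') \<le> norm (x - y) + norm (x' - y)" using norm_triangle_ineq4[of "x - y" "x' - y"] by simp
  also have "\<dots> \<le> 3 * s" using y[OF assms(3)] y[OF assms(4)] by linarith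
  also have "\<dots> \<le> 3 * K / \<delta>" using assms by simp
  finally show ?thesis .
qed

text \<open>As \<open>r \<ge> 1\<close>, every cube meets some plate and so lies near the ambient
  box; packing with the identity map applies. This gives finiteness and settles bounded
  \<open>r\<close>.\<close>

lemma cubes_in_box_le:
  fixes K \<delta> :: real
  assumes K: "K \<ge> 1" and \<delta>: "0 < \<delta>" "\<delta> < 1"
    and S: "plate_collection K \<delta> \<S>" and Q: "rich_cubes K \<delta> \<S> r Q" and r: "r \<ge> 1"
  shows "finite Q \<and> real (card Q) \<le> (32 * K^2) ^ 3 / \<delta>^3"
proof -
  have id: "det (matrix (\<lambda>x::real^3. x)) = 1" using matrix_id unfolding id_def .
  have "finite Q \<and> real (card Q) \<le> (8 * K * \<delta> * (4 * K / \<delta>^2)) ^ 3 / \<bar>det (matrix (\<lambda>x::real^3. x))\<bar>"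
  proof (rule disjoint_cubes_packing[where a = 0])
    show "\<exists>s. is_cube s q \<and> 1 / (K * \<delta>) \<le> s" if "q \<in> Q" for q
      using that Q by (auto simp: rich_cubes_def)
    fix q x i assume q: "q \<in> Q" and x: "x \<in> q"
    have "r \<le> real (card {(I, S) \<in> \<S>. S \<inter> q \<noteq> {}})" using Q q by (auto simp: rich_cubes_def)
    then have "{(I, S) \<in> \<S>. S \<inter> q \<noteq> {}} \<noteq> {}" using r by (intro notI) simp
    then obtain I S x' where IS: "(I, S) \<in> \<S>" "x' \<in> S" "x' \<in> q" by auto
    have x': "\<bar>x' $ i\<bar> \<le> 1 / \<delta>^2" using S IS by (fastforce simp: plate_collection_def)
    obtain s where s: "is_cube s q" "s \<le> K / \<delta>" using Q q by (auto simp: rich_cubes_def)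
    have "\<bar>(x - x') $ i\<bar> \<le> norm (x - x')" by (rule component_le_norm_cart)
    also have "\<dots> \<le> 3 * K / \<delta>" by (rule cube_diameter[OF s x IS(3)])
    also have "\<dots> \<le> 3 * K / \<delta>^2" using K \<delta> by (simp add: field_simps power2_eq_square)
    finally have "\<bar>x $ i\<bar> \<le> 3 * K / \<delta>^2 + 1 / \<delta>^2" using x' by simp
    also have "\<dots> \<le> 4 * K / \<delta>^2" using K \<delta> by (simp add: field_simps)
    finally show "\<bar>x $ i - 0 $ i\<bar> \<le> 4 * K / \<delta>^2" by simp
  qed (use Q K \<delta> id in \<open>auto simp: rich_cubes_def linear_iff\<close>)
  then show ?thesis unfolding id using \<delta> by (simp add: power2_eq_square power3_eq_cube field_simps)
qed

text \<open>A cube meeting a plate lies entirely in a slab of half-width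
  \<open>14 * K / \<delta>\<close>. The three tangent functionals map the intersection of three such
  slabs into a cube, and their determinant is 6 times the Vandermonde product.\<close>

lemma cubes_meeting_three_plates_le:
  fixes K \<delta> :: real
  assumes K: "K \<ge> 1" and \<delta>: "0 < \<delta>" "\<delta> < 1"
    and Q: "disjoint Q" "\<And>q. q \<in> Q \<Longrightarrow> \<exists>s. is_cube s q \<and> 1 / (K * \<delta>) \<le> s \<and> s \<le> K / \<delta>"
    and plates: "vinogradov_plate K \<delta> I1 S1" "vinogradov_plate K \<delta> I2 S2" "vinogradov_plate K \<delta> I3 S3"
    and I: "Inf I1 = c1" "Inf I2 = c2" "Inf I3 = c3"
    and c: "c1 \<in> {0..1}" "c2 \<in> {0..1}" "c3 \<in> {0..1}" "c1 \<noteq> c2" "c2 \<noteq> c3" "c1 \<noteq> c3"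
  shows "real (card {q \<in> Q. S1 \<inter> q \<noteq> {} \<and> S2 \<inter> q \<noteq> {} \<and> S3 \<inter> q \<noteq> {}}) \<le>
    (112 * K^2) ^ 3 / (\<bar>c1 - c3\<bar> * \<bar>c3 - c2\<bar> * \<bar>c1 - c2\<bar>)"
proof -
  have slab: "\<exists>p. \<forall>q\<in>Q. S \<inter> q \<noteq> {} \<longrightarrow> (\<forall>x\<in>q. \<bar>x \<bullet> tangent (Inf J) - p \<bullet> tangent (Inf J)\<bar> \<le> 14 * K / \<delta>)"
    if S: "vinogradov_plate K \<delta> J S" and J: "Inf J \<in> {0..1}" for S J
  proof -
    obtain p where p: "\<And>x. x \<in> S \<Longrightarrow> \<bar>(x - p) \<bullet> tangent (Inf J)\<bar> \<le> 2 * K / \<delta>"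
      using plate_slab[OF K \<delta> _ _ S] J unfolding atLeastAtMost_iff by metis
    have "\<bar>x \<bullet> tangent (Inf J) - p \<bullet> tangent (Inf J)\<bar> \<le> 14 * K / \<delta>"
      if q: "q \<in> Q" "x' \<in> S" "x' \<in> q" "x \<in> q" for q x x'
    proof -
      obtain s where s: "is_cube s q" "s \<le> K / \<delta>" using Q(2)[OF q(1)] by blast
      have "\<bar>(x - x') \<bullet> tangent (Inf J)\<bar> \<le> 4 * (3 * K / \<delta>)"
        by (rule inner_tangent_le) (use J cube_diameter[OF s q(4,3)] in auto)
      moreover have "4 * (3 * K / \<delta>) + 2 * K / \<delta> = 14 * K / \<delta>" by (simp add: field_simps)
      ultimately show ?thesis using p[OF q(2)] unfolding inner_diff_left by linarith
    qed
    then show ?thesis by blast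
  qed
  define Q' where "Q' = {q \<in> Q. S1 \<inter> q \<noteq> {} \<and> S2 \<inter> q \<noteq> {} \<and> S3 \<inter> q \<noteq> {}}"
  obtain p1 where p1: "\<And>q x. q \<in> Q' \<Longrightarrow> x \<in> q \<Longrightarrow> \<bar>x \<bullet> tangent c1 - p1 \<bullet> tangent c1\<bar> \<le> 14 * K / \<delta>"
    using slab[OF plates(1)] I c unfolding Q'_def by auto
  obtain p2 where p2: "\<And>q x. q \<in> Q' \<Longrightarrow> x \<in> q \<Longrightarrow> \<bar>x \<bullet> tangent c2 - p2 \<bullet> tangent c2\<bar> \<le> 14 * K / \<delta>"
    using slab[OF plates(2)] I c unfolding Q'_def by auto
  obtain p3 where p3: "\<And>q x. q \<in> Q' \<Longrightarrow> x \<in> q \<Longrightarrow> \<bar>x \<bullet> tangent c3 - p3 \<bullet> tangent c3\<bar> \<le> 14 * K / \<delta>"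
    using slab[OF plates(3)] I c unfolding Q'_def by auto
  define f where "f = (\<lambda>z::real^3. vector [z \<bullet> tangent c1, z \<bullet> tangent c3, z \<bullet> tangent c2] :: real^3)"
  note f = det_tangents[OF f_def]
  define w where "w = \<bar>c1 - c3\<bar> * \<bar>c3 - c2\<bar> * \<bar>c1 - c2\<bar>"
  have w: "w > 0" using c by (simp add: w_def)
  have det: "\<bar>det (matrix f)\<bar> = 6 * w"
    unfolding f w_def abs_mult by (simp add: abs_minus_commute mult_ac)
  have "finite Q' \<and> real (card Q') \<le> (8 * K * \<delta> * (14 * K / \<delta>)) ^ 3 / \<bar>det (matrix f)\<bar>"
  proof (rule disjoint_cubes_packing[OF K \<delta>(1) _ _ f(1)])
    show "disjoint Q'" using Q(1) unfolding Q'_def disjoint_def by blast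
    show "\<exists>s. is_cube s q \<and> 1 / (K * \<delta>) \<le> s" if "q \<in> Q'" for q
      using Q(2) that unfolding Q'_def by blast
    show "det (matrix f) \<noteq> 0" using det w by auto
    show "\<bar>f x $ i - (vector [p1 \<bullet> tangent c1, p3 \<bullet> tangent c3, p2 \<bullet> tangent c2] :: real^3) $ i\<bar> \<le> 14 * K / \<delta>"
      if "q \<in> Q'" "x \<in> q" for q x i
    proof -
      have "\<forall>i. \<bar>f x $ i - (vector [p1 \<bullet> tangent c1, p3 \<bullet> tangent c3, p2 \<bullet> tangent c2] :: real^3) $ i\<bar> \<le> 14 * K / \<delta>"
        using p1[OF that] p2[OF that] p3[OF that] by (simp add: forall_3 f_def)
      then show ?thesis by blast
    qed
  qed (use K \<delta> in auto)
  then have "real (card Q') \<le> (112 * K^2) ^ 3 / (6 * w)"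
    unfolding det using \<delta> by (simp add: power2_eq_square)
  also have "\<dots> \<le> (112 * K^2) ^ 3 / w"
    by (rule divide_left_mono) (use w in auto)
  finally show ?thesis by (simp add: Q'_def w_def)
qed

text \<open>Passing from left endpoints to indices extracts one factor \<open>\<delta>\<close> from
  each of the three differences.\<close>

lemma cubes_meeting_distinct_plates_le:
  fixes K \<delta> :: real
  assumes K: "K \<ge> 1" and \<delta>: "0 < \<delta>" "\<delta> < 1"
    and S: "plate_collection K \<delta> \<S>"
    and Q: "disjoint Q" "\<And>q. q \<in> Q \<Longrightarrow> \<exists>s. is_cube s q \<and> 1 / (K * \<delta>) \<le> s \<and> s \<le> K / \<delta>"
    and x: "x \<in> \<S>" "y \<in> \<S>" "z \<in> \<S>" and col: "col = (\<lambda>x. col_index \<delta> (fst x))"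
    and ne: "col x \<noteq> col y" "col z \<noteq> col x" "col z \<noteq> col y"
  shows "real (card {q \<in> Q. snd x \<inter> q \<noteq> {} \<and> snd y \<inter> q \<noteq> {} \<and> snd z \<inter> q \<noteq> {}}) \<le>
    ((112 * K^2) ^ 3 / \<delta>^3) /
      (\<bar>real (col x) - real (col z)\<bar> * \<bar>real (col z) - real (col y)\<bar> * \<bar>real (col x) - real (col y)\<bar>)"
proof -
  have plate: "vinogradov_plate K \<delta> (fst u) (snd u)" and int: "fst u \<in> intervals \<delta>" if "u \<in> \<S>" for u
    using S that by (auto simp: plate_collection_def)
  have c: "real (col u) * \<delta> \<in> {0..1}" "Inf (fst u) = real (col u) * \<delta>" if "u \<in> \<S>" for u
    using col_index_interval[OF \<delta>(1) int[OF that]] \<delta> by (auto simp: col)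
  have d: "\<bar>real i * \<delta> - real j * \<delta>\<bar> = \<delta> * \<bar>real i - real j\<bar>" for i j
    using \<delta> by (simp add: left_diff_distrib[symmetric] abs_mult)
  have "real (card {q \<in> Q. snd x \<inter> q \<noteq> {} \<and> snd y \<inter> q \<noteq> {} \<and> snd z \<inter> q \<noteq> {}}) \<le>
    (112 * K^2) ^ 3 / (\<bar>real (col x) * \<delta> - real (col z) * \<delta>\<bar> * \<bar>real (col z) * \<delta> - real (col y) * \<delta>\<bar>
      * \<bar>real (col x) * \<delta> - real (col y) * \<delta>\<bar>)"
    by (rule cubes_meeting_three_plates_le[OF K \<delta> Q plate[OF x(1)] plate[OF x(2)] plate[OF x(3)] c(2)[OF x(1)]
        c(2)[OF x(2)] c(2)[OF x(3)] c(1)[OF x(1)] c(1)[OF x(2)] c(1)[OF x(3)]]) (use ne \<delta> in auto)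
  also have "\<dots> = ((112 * K^2) ^ 3 / \<delta>^3) /
      (\<bar>real (col x) - real (col z)\<bar> * \<bar>real (col z) - real (col y)\<bar> * \<bar>real (col x) - real (col y)\<bar>)"
    unfolding d by (simp add: power3_eq_cube mult_ac)
  finally show ?thesis .
qed

lemma card_rich_cubes_le:
  fixes K \<delta> r :: real and N :: nat
  assumes K: "K \<ge> 1" and \<delta>: "0 < \<delta>" "\<delta> < 1"
    and S: "plate_collection K \<delta> \<S>" "separated K \<delta> \<S>"
    and N: "\<forall>I \<in> intervals \<delta>. card (plates_of \<S> I) \<le> N"
    and r: "4 * overlap_const K \<le> r" and Q: "rich_cubes K \<delta> \<S> r Q" and finQ: "finite Q"
  shows "real (card Q) * r ^ 4 \<le> 256 * overlap_const K * ((112 * K^2) ^ 3 / \<delta>^3) *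
    harm (nat \<lceil>1 / \<delta>\<rceil>) ^ 2 * (real (card \<S>) * real N ^ 2)"
proof -
  define col where "col = (\<lambda>x :: real set \<times> (real^3) set. col_index \<delta> (fst x))"
  have int: "fst u \<in> intervals \<delta>" if "u \<in> \<S>" for u
    using S that by (auto simp: plate_collection_def)
  have fin: "finite \<S>" using S by (simp add: plate_collection_def)
  have M: "overlap_const K > 0" using K by (simp add: overlap_const_def add_nonneg_pos)
  have cube: "\<exists>s. is_cube s q \<and> 1 / (K * \<delta>) \<le> s \<and> s \<le> K / \<delta>" if "q \<in> Q" for q
    using Q that by (auto simp: rich_cubes_def)
  \<comment> \<open>The index determines the interval, so a colour class is a copy of the plates of
    one interval; this carries the bounds \<open>N\<close> and \<open>overlap_const K\<close> over
    to colours.\<close>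
  have fibre: "card {x \<in> \<S>. P (snd x) \<and> col x = i} = card {S \<in> plates_of \<S> I. P S}"
    if "I \<in> intervals \<delta>" "col_index \<delta> I = i" for P i I
  proof -
    have "{x \<in> \<S>. P (snd x) \<and> col x = i} = Pair I ` {S \<in> plates_of \<S> I. P S}"
      using that int col_index_eq_iff[OF \<delta>(1)] by (auto simp: plates_of_def col_def image_iff)
    then show ?thesis by (simp add: card_image inj_on_def)
  qed
  have fibre0: "{x \<in> \<S>. P (snd x) \<and> col x = i} = {}" if "\<forall>I\<in>intervals \<delta>. col_index \<delta> I \<noteq> i" for P i
    using that int by (auto simp: col_def)
  show ?thesis
  proof (rule card_rich_le[where col = col and meets = "\<lambda>q x. snd x \<inter> q \<noteq> {}", OF fin finQ M r])
    show "0 \<le> (112 * K^2) ^ 3 / \<delta>^3" using K \<delta> by simp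
    show "col x < nat \<lceil>1 / \<delta>\<rceil>" if "x \<in> \<S>" for x
    proof -
      have "real (col x) < 1 / \<delta>"
        using col_index_interval(3)[OF \<delta>(1) int[OF that]] \<delta> by (simp add: col_def field_simps)
      then show ?thesis by linarith
    qed
    show "real (card {x \<in> \<S>. col x = i}) \<le> real N" for i
    proof (cases "\<exists>I\<in>intervals \<delta>. col_index \<delta> I = i")
      case True
      then obtain I where "I \<in> intervals \<delta>" "col_index \<delta> I = i" by blast
      then show ?thesis using fibre[of I i "\<lambda>_. True"] N by simp
    next
      case False
      then have "{x \<in> \<S>. col x = i} = {}" using fibre0[of i "\<lambda>_. True"] by simp
      then show ?thesis by (simp only: card.empty of_nat_0 of_nat_0_le_iff)
    qed
    show "real (card {x \<in> \<S>. snd x \<inter> q \<noteq> {} \<and> col x = i}) \<le> overlap_const K" if q: "q \<in> Q" for q i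
    proof (cases "\<exists>I\<in>intervals \<delta>. col_index \<delta> I = i")
      case True
      then obtain I where I: "I \<in> intervals \<delta>" "col_index \<delta> I = i" by blast
      have "real (card {S \<in> plates_of \<S> I. S \<inter> q \<noteq> {}}) \<le> overlap_const K"
        by (rule plates_meeting_cube_le[OF K \<delta> S I(1)]) (use cube[OF q] cube_diameter in blast)
      then show ?thesis using fibre[OF I, of "\<lambda>S. S \<inter> q \<noteq> {}"] by simp
    next
      case False
      then have "{x \<in> \<S>. snd x \<inter> q \<noteq> {} \<and> col x = i} = {}"
        using fibre0[of i "\<lambda>S. S \<inter> q \<noteq> {}"] by simp
      then show ?thesis using M by (simp only: card.empty of_nat_0)
    qed
    show "r \<le> real (card {x \<in> \<S>. snd x \<inter> q \<noteq> {}})" if "q \<in> Q" for q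
    proof -
      have "{(I, S) \<in> \<S>. S \<inter> q \<noteq> {}} = {x \<in> \<S>. snd x \<inter> q \<noteq> {}}" by auto
      then show ?thesis using Q that by (auto simp: rich_cubes_def)
    qed
    show "real (card {q \<in> Q. snd x \<inter> q \<noteq> {} \<and> snd y \<inter> q \<noteq> {} \<and> snd z \<inter> q \<noteq> {}}) \<le>
      ((112 * K^2) ^ 3 / \<delta>^3) /
      (\<bar>real (col x) - real (col z)\<bar> * \<bar>real (col z) - real (col y)\<bar> * \<bar>real (col x) - real (col y)\<bar>)"
      if "x \<in> \<S>" "y \<in> \<S>" "z \<in> \<S>" "col x \<noteq> col y" "col z \<noteq> col x" "col z \<noteq> col y" for x y z
      by (rule cubes_meeting_distinct_plates_le[OF K \<delta> S(1) _ cube that(1-3) col_def that(4-6)])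
        (use Q in \<open>simp add: rich_cubes_def\<close>)
  qed
qed

section \<open>Logarithmic factors and the final estimate\<close>

text \<open>For \<open>\<delta> < 1 / 3\<close> one has \<open>1 / \<delta> \<ge> exp 1\<close>, so
  the additive constants \<open>ln 2\<close> and 1 are absorbed into multiples of the
  logarithm.\<close>

lemma harm_ceiling_inverse_le:
  fixes \<delta> :: real
  assumes "0 < \<delta>" "\<delta> < 1 / 3"
  shows "1 \<le> ln (1 / \<delta>)" "harm (nat \<lceil>1 / \<delta>\<rceil>) \<le> 3 * ln (1 / \<delta>)"
proof -
  have "3 \<le> 1 / \<delta>" using assms by (simp add: field_simps)
  then have "exp 1 \<le> 1 / \<delta>" using exp_le by linarith
  then show l: "1 \<le> ln (1 / \<delta>)" using assms by (simp add: ln_ge_iff)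
  define n where "n = nat \<lceil>1 / \<delta>\<rceil>"
  have "1 / \<delta> > 1" using assms by (simp add: field_simps)
  then have n: "n > 0" "real n \<le> 1 / \<delta> + 1" "1 / \<delta> + 1 \<le> 2 * (1 / \<delta>)" unfolding n_def by linarith+
  have "harm n \<le> ln (real n) + 1" by (rule harm_le_ln[OF n(1)])
  also have "ln (real n) \<le> ln (2 * (1 / \<delta>))" using n assms by (subst ln_le_cancel_iff) auto
  also have "\<dots> = ln 2 + ln (1 / \<delta>)" using assms by (subst ln_mult) auto
  finally show "harm (nat \<lceil>1 / \<delta>\<rceil>) \<le> 3 * ln (1 / \<delta>)"
    using l ln_2_less_1 unfolding n_def by linarith
qed

text \<open>The triple count needs \<open>r \<ge> 4 * overlap_const K\<close> and yields the second
  summand of \<open>C\<close>, with \<open>9 = 3 ^ 2\<close> from the logarithms. For smaller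
  \<open>r\<close> the factor \<open>r ^ 4\<close> is bounded and the ambient box count yields the
  first summand.\<close>

lemma card_rich_cubes_le_log:
  fixes K \<delta> r :: real and N :: nat
  assumes K: "K \<ge> 1" and \<delta>: "0 < \<delta>" "\<delta> < 1 / 3"
    and S: "plate_collection K \<delta> \<S>" "separated K \<delta> \<S>"
    and N: "\<forall>I \<in> intervals \<delta>. card (plates_of \<S> I) \<le> N"
    and r: "1 \<le> r" and Q: "rich_cubes K \<delta> \<S> r Q"
  defines "C \<equiv> (32 * K^2) ^ 3 * (4 * overlap_const K) ^ 4 + 256 * overlap_const K * (112 * K^2) ^ 3 * 9"
  shows "real (card Q) * r ^ 4 \<le> C * ln (1 / \<delta>) ^ 2 * (real (card \<S>) * real N ^ 2 * (1 / \<delta>) ^ 3)"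
proof -
  have \<delta>1: "\<delta> < 1" using \<delta> by simp
  note tot = cubes_in_box_le[OF K \<delta>(1) \<delta>1 S(1) Q r]
  note h = harm_ceiling_inverse_le[OF \<delta>]
  define X where "X = real (card \<S>) * real N ^ 2"
  define l where "l = ln (1 / \<delta>)"
  define C1 where "C1 = (32 * K^2) ^ 3 * (4 * overlap_const K) ^ 4"
  define C2 where "C2 = 256 * overlap_const K * (112 * K^2) ^ 3 * 9"
  have M: "overlap_const K > 0" using K by (simp add: overlap_const_def add_nonneg_pos)
  have X0: "X \<ge> 0" by (simp add: X_def)
  have C0: "C1 \<ge> 0" "C2 \<ge> 0" using M K by (simp_all add: C1_def C2_def)
  have l2: "1 \<le> l ^ 2" using h(1) by (simp add: l_def one_le_power)
  have "real (card Q) * r ^ 4 \<le> (C1 + C2) * l ^ 2 * (X * (1 / \<delta>) ^ 3)"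
  proof (cases "4 * overlap_const K \<le> r")
    case True
    have "real (card Q) * r ^ 4 \<le> 256 * overlap_const K * ((112 * K^2) ^ 3 / \<delta>^3) *
        harm (nat \<lceil>1 / \<delta>\<rceil>) ^ 2 * X"
      unfolding X_def using card_rich_cubes_le[OF K \<delta>(1) \<delta>1 S N True Q] tot by blast
    also have "\<dots> \<le> 256 * overlap_const K * ((112 * K^2) ^ 3 / \<delta>^3) * (3 * l) ^ 2 * X"
      by (intro mult_right_mono mult_left_mono power_mono)
        (use h M K \<delta> X0 in \<open>auto simp: l_def harm_nonneg\<close>)
    also have "\<dots> = C2 * l ^ 2 * (X * (1 / \<delta>) ^ 3)"
      by (simp add: C2_def power_mult_distrib power_divide)
    also have "\<dots> \<le> (C1 + C2) * l ^ 2 * (X * (1 / \<delta>) ^ 3)"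
      by (intro mult_right_mono) (use C0 X0 \<delta> in auto)
    finally show ?thesis .
  next
    case False
    show ?thesis
    proof (cases "Q = {}")
      case True
      then show ?thesis using C0 X0 \<delta> by simp
    next
      case False
      \<comment> \<open>A cube of \<open>Q\<close> produces a plate, so \<open>card \<S>\<close> and
        \<open>N\<close> are at least 1, and the ambient box count may be multiplied by
        \<open>X \<ge> 1\<close>.\<close>
      then obtain q where "q \<in> Q" by blast
      then have "r \<le> real (card {(I, S) \<in> \<S>. S \<inter> q \<noteq> {}})" using Q by (auto simp: rich_cubes_def)
      then have "{(I, S) \<in> \<S>. S \<inter> q \<noteq> {}} \<noteq> {}" using r by (intro notI) simp
      then obtain I S' where IS: "(I, S') \<in> \<S>" by auto
      have fin: "finite \<S>" using S by (simp add: plate_collection_def)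
      have "finite (plates_of \<S> I)"
        by (rule finite_subset[OF _ finite_imageI[OF fin, of snd]]) (force simp: plates_of_def)
      then have "card (plates_of \<S> I) \<ge> 1" using IS by (auto simp: Suc_le_eq card_gt_0_iff plates_of_def)
      moreover have "I \<in> intervals \<delta>" using S IS by (auto simp: plate_collection_def)
      ultimately have "real N ^ 2 \<ge> 1" using N by (intro one_le_power) fastforce
      moreover have "real (card \<S>) \<ge> 1" using IS fin by (auto simp: Suc_le_eq card_gt_0_iff)
      ultimately have X1: "X \<ge> 1" unfolding X_def using mult_mono[of 1 "real (card \<S>)" 1 "real N ^ 2"] by simp
      have "real (card Q) * r ^ 4 \<le> ((32 * K^2) ^ 3 / \<delta>^3) * (4 * overlap_const K) ^ 4"
        by (intro mult_mono power_mono) (use tot \<open>\<not> 4 * overlap_const K \<le> r\<close> r \<delta> K in auto)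
      also have "\<dots> = C1 * 1 * (1 * (1 / \<delta>) ^ 3)" by (simp add: C1_def power_divide)
      also have "\<dots> \<le> (C1 + C2) * l ^ 2 * (X * (1 / \<delta>) ^ 3)"
        by (intro mult_mono) (use C0 X1 l2 \<delta> in auto)
      finally show ?thesis .
    qed
  qed
  then show ?thesis by (simp add: C_def C1_def C2_def X_def l_def)
qed

theorem theorem6p3:
  fixes K :: real
  assumes "K \<ge> 1"
  shows "\<exists>C>0. \<exists>\<delta>\<^sub>0\<in>{0<..<1}. \<forall>(\<delta>::real) (\<S>::plates) (N::nat) (r::real) (Q::(real^3) set set).
    0 < \<delta> \<longrightarrow> \<delta> < \<delta>\<^sub>0 \<longrightarrow>
    plate_collection K \<delta> \<S> \<longrightarrow> separated K \<delta> \<S> \<longrightarrow>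
    (\<forall>I \<in> intervals \<delta>. card (plates_of \<S> I) \<le> N) \<longrightarrow>
    r \<ge> 1 \<longrightarrow> rich_cubes K \<delta> \<S> r Q \<longrightarrow>
    finite Q \<and>
    real (card Q) \<le> C * ln (1 / \<delta>) powr C * (real (card \<S>) * real N ^ 2 * (1 / \<delta>) ^ 3 / r ^ 4)"
proof -
  define C0 where "C0 = (32 * K^2) ^ 3 * (4 * overlap_const K) ^ 4 + 256 * overlap_const K * (112 * K^2) ^ 3 * 9"
  \<comment> \<open>One constant serves as factor and as exponent: it exceeds \<open>C0\<close> and
    is at least the exponent 2 of the logarithm, whose powers increase since it is at least
    1.\<close>
  define C where "C = C0 + 2"
  have M: "overlap_const K > 0" using assms by (simp add: overlap_const_def add_nonneg_pos)
  then have C0: "C0 \<ge> 0" by (simp add: C0_def)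
  have main: "finite Q \<and>
    real (card Q) \<le> C * ln (1 / \<delta>) powr C * (real (card \<S>) * real N ^ 2 * (1 / \<delta>) ^ 3 / r ^ 4)"
    if \<delta>: "0 < \<delta>" "\<delta> < 1 / 3" and S: "plate_collection K \<delta> \<S>" "separated K \<delta> \<S>"
    and N: "\<forall>I \<in> intervals \<delta>. card (plates_of \<S> I) \<le> N" and r: "r \<ge> 1" and Q: "rich_cubes K \<delta> \<S> r Q"
    for \<delta> r :: real and \<S> :: plates and N :: nat and Q :: "(real^3) set set"
  proof
    show "finite Q" using cubes_in_box_le[OF assms \<delta>(1) _ S(1) Q r] \<delta> by simp
    define X where "X = real (card \<S>) * real N ^ 2 * (1 / \<delta>) ^ 3"
    have X: "X \<ge> 0" using \<delta> by (simp add: X_def)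
    have l: "1 \<le> ln (1 / \<delta>)" by (rule harm_ceiling_inverse_le(1)[OF \<delta>])
    have "ln (1 / \<delta>) ^ 2 = ln (1 / \<delta>) powr 2" using l by (subst powr_numeral) auto
    also have "\<dots> \<le> ln (1 / \<delta>) powr C" by (rule powr_mono) (use l C0 in \<open>auto simp: C_def\<close>)
    finally have l2: "ln (1 / \<delta>) ^ 2 \<le> ln (1 / \<delta>) powr C" .
    have "real (card Q) * r ^ 4 \<le> C0 * ln (1 / \<delta>) ^ 2 * X"
      unfolding C0_def X_def by (rule card_rich_cubes_le_log[OF assms \<delta> S N r Q])
    also have "\<dots> \<le> C * ln (1 / \<delta>) powr C * X"
      by (intro mult_right_mono mult_mono l2) (use X C0 in \<open>auto simp: C_def\<close>)
    finally show "real (card Q) \<le> C * ln (1 / \<delta>) powr C *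
        (real (card \<S>) * real N ^ 2 * (1 / \<delta>) ^ 3 / r ^ 4)"
      using r unfolding X_def[symmetric] by (simp add: pos_le_divide_eq)
  qed
  show ?thesis
  proof (intro exI conjI bexI allI impI)
    show "C > 0" using C0 by (simp add: C_def)
    show "1 / 3 \<in> {0<..<1::real}" by simp
  qed (use main in blast)+
qed

end
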